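(* Let $n\ge2$, let $\mathcal O$ be a $\varphi$-orbit of $\mathcal I_n$, and let $c$ be a snake composition of a snake in (the orbit board of) $\mathcal O$. Let $N_1(c)$ be the number of occurrences of $1$ in $c$ and $N_2(c)$ the number of occurrences of $2$ in $c$. Then $$\#\mathcal O=\frac{3N_1(c)+2N_2(c)}{\psi(c)}.$$
   Context: $[n]=\{1,\dots,n\}$. $\mathcal I_n$ is the set of independent sets of the path graph on $[n]$, i.e. subsets $S\subseteq[n]$ containing no two consecutive integers. For $i\in[n]$ the toggle $\tau_i:\mathcal I_n\to\mathcal I_n$ is defined by: $\tau_i(S)=S\setminus\{i\}$ if $i\in S$; $\tau_i(S)=S\cup\{i\}$ if $i\notin S$ and $S\cup\{i\}\in\mathcal I_n$; and $\tau_i(S)=S$ otherwise. $\varphi=\tau_n\cdots\tau_2\tau_1$, composed from right to left ($\tau_1$ is applied first). Orbit board: for $S\in\mathcal I_n$ and $i\in\mathbb Z$ put $S^i=\varphi^i(S)$, and set $S(i,j)=1$ if $j\in S^i$ and $S(i,j)=0$ otherwise (in particular $S(i,j)=0$ for $j<1$ or $j>n$). Snakes: whenever $S(i,j)=1$ and $j\neq n$, exactly one of $S(i,j+2)=1$ and $S(i+1,j+1)=1$ holds; similarly, whenever $S(i,j)=1$ and $j\ne1$, exactly one of $S(i,j-2)=1$ and $S(i-1,j-1)=1$ holds. Hence the ones of the orbit board are partitioned into sequences called snakes, each beginning in column $1$ and ending in column $n$, where each $1$ at $(i,j)$ with $j\ne n$ is followed by the $1$ at $(i,j+2)$ or at $(i+1,j+1)$.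 The snake composition of a snake is the sequence recording its steps in order: a step from $(i,j)$ to $(i,j+2)$ is recorded as $2$ and a step from $(i,j)$ to $(i+1,j+1)$ is recorded as $1$; it is a composition of $n-1$ with parts in $\{1,2\}$. For a composition (finite sequence) $c$, $\psi(c)$ is the number of times the smallest segment whose repetition makes up $c$ is repeated; i.e. $\psi(c)$ is the largest $k$ such that $c$ is the concatenation of $k$ copies of a single sequence (e.g. $\psi(21221)=1$, $\psi(22122212)=2$, $\psi(222)=3$). *)

theory Defs
  imports Complex_Main
begin

definition indep_sets :: "nat \<Rightarrow> nat set set" where
  "indep_sets n = {S. S \<subseteq> {1..n} \<and> (\<forall>i. \<not> (i \<in> S \<and> Suc i \<in> S))}"

definition toggle :: "nat \<Rightarrow> nat \<Rightarrow> nat set \<Rightarrow> nat set" where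
  "toggle n i S =
    (if i \<in> S then S - {i}
     else if insert i S \<in> indep_sets n then insert i S
     else S)"

(* fold processes the list from the left, so toggle 1 is applied first and toggle n last *)
definition phi :: "nat \<Rightarrow> nat set \<Rightarrow> nat set" where
  "phi n = fold (toggle n) [1..<Suc n]"

(* The maps above are total on nat sets; only on indep_sets n is phi n a permutation,
   so its inverse has to be taken there. *)

lemma toggle_mem: "S \<in> indep_sets n \<Longrightarrow> toggle n i S \<in> indep_sets n"
  by (auto simp: toggle_def indep_sets_def)

lemma toggle_toggle: "S \<in> indep_sets n \<Longrightarrow> toggle n i (toggle n i S) = S"
  by (auto simp: toggle_def insert_absorb)

lemma bij_betw_phi: "bij_betw (phi n) (indep_sets n) (indep_sets n)"
proof -
  have t: "bij_betw (toggle n i) (indep_sets n) (indep_sets n)" for i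
    by (rule bij_betw_byWitness[where f' = "toggle n i"])
      (auto simp: toggle_toggle toggle_mem)
  have "bij_betw (fold (toggle n) xs) (indep_sets n) (indep_sets n)" for xs
  proof (induction xs)
    case Nil
    show ?case by (simp add: bij_betw_def)
  next
    case (Cons x xs)
    then show ?case using bij_betw_trans[OF t Cons.IH] by (simp add: comp_def)
  qed
  then show ?thesis by (simp add: phi_def)
qed

definition phi_power :: "nat \<Rightarrow> int \<Rightarrow> nat set \<Rightarrow> nat set" where
  "phi_power n i S =
    (if 0 \<le> i then (phi n ^^ nat i) S
     else (inv_into (indep_sets n) (phi n) ^^ nat (- i)) S)"

definition phi_orbit :: "nat \<Rightarrow> nat set \<Rightarrow> nat set set" where
  "phi_orbit n S = {phi_power n i S | i. True}"

definition phi_orbits :: "nat \<Rightarrow> nat set set set" where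
  "phi_orbits n = phi_orbit n ` indep_sets n"

(* Columns are natural numbers; columns 0 and j > n contain only zeros. *)
definition orbit_board :: "nat \<Rightarrow> nat set \<Rightarrow> int \<Rightarrow> nat \<Rightarrow> nat" where
  "orbit_board n S i j = (if j \<in> phi_power n i S then 1 else 0)"

(* A snake is the list of positions (row, column) of its ones, from column 1 to column n.
   The length condition excludes the empty list; a one in a column other than n has
   exactly one of the two possible successors. *)
definition is_snake :: "nat \<Rightarrow> nat set \<Rightarrow> (int \<times> nat) list \<Rightarrow> bool" where
  "is_snake n S ps \<longleftrightarrow>
    0 < length ps \<and> snd (hd ps) = 1 \<and> snd (last ps) = n \<and>
    (\<forall>(i, j) \<in> set ps. orbit_board n S i j = 1) \<and>
    (\<forall>k. Suc k < length ps \<longrightarrow>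
      (let (i, j) = ps ! k in ps ! Suc k = (i, j + 2) \<or> ps ! Suc k = (i + 1, j + 1)))"

fun snake_composition :: "(int \<times> nat) list \<Rightarrow> nat list" where
  "snake_composition ((i, j) # p # ps) =
    (if p = (i, j + 2) then 2 else 1) # snake_composition (p # ps)"
| "snake_composition _ = []"

(* Only meaningful for nonempty c: the empty list is a k-fold repetition for every k. *)
definition psi :: "'a list \<Rightarrow> nat" where
  "psi c = Max {k. \<exists>d. c = concat (replicate k d)}"

end

theory Submission imports Defs begin

text \<open>Let \<open>D k\<close> be the number of 1s among the first \<open>k\<close> letters of the periodic two-sided infinite
  repetition of \<open>c\<close>, and put \<open>W k = 2 * k - D k\<close>, the sum of these letters. The \<open>a\<close>-th snake, counted
  from the given one, reads the word from position \<open>a\<close> on, and its entry at position \<open>b\<close> lies in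
  row \<open>2 * a + D b\<close> and column \<open>1 + W b - W a\<close>. These positions satisfy the local toggling rule,
  and the given snake determines the board below itself, hence everywhere. The ones of column 1
  are in the rows \<open>2 * a + D a\<close>, so the board has period \<open>2 * q + D q\<close>, where \<open>q\<close> is the least
  period of the word, namely the length of \<open>c\<close> divided by \<open>psi c\<close>.\<close>

section \<open>Toggles and the local rule for \<open>phi\<close>\<close>

lemma toggle_same_mem:
  assumes "A \<in> indep_sets n" "Suc j \<le> n"
  shows "Suc j \<in> toggle n (Suc j) A \<longleftrightarrow> Suc j \<notin> A \<and> Suc (Suc j) \<notin> A \<and> j \<notin> A"
  using assms by (auto simp: toggle_def indep_sets_def)

lemma toggle_other_mem: "i \<noteq> j \<Longrightarrow> i \<in> toggle n j A \<longleftrightarrow> i \<in> A"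
  by (auto simp: toggle_def)

lemma indep_setsD:
  assumes "A \<in> indep_sets n"
  shows "0 \<notin> A" "j \<in> A \<Longrightarrow> j \<le> n" "j \<in> A \<Longrightarrow> Suc j \<notin> A"
  using assms by (auto simp: indep_sets_def)

lemma fold_toggle_indep: "A \<in> indep_sets n \<Longrightarrow> fold (toggle n) xs A \<in> indep_sets n"
  by (induction xs arbitrary: A) (auto simp: toggle_mem)

lemma fold_toggle_notin: "i \<notin> set xs \<Longrightarrow> i \<in> fold (toggle n) xs A \<longleftrightarrow> i \<in> A"
  by (induction xs arbitrary: A) (auto simp: toggle_other_mem)

text \<open>When \<open>toggle n (Suc j)\<close> acts, the columns up to \<open>j\<close> already
  have their final values, and those beyond \<open>Suc j\<close> still their old ones.\<close>

lemma phi_mem_iff: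
  assumes A: "A \<in> indep_sets n" and j: "Suc j \<le> n"
  shows "Suc j \<in> phi n A \<longleftrightarrow> Suc j \<notin> A \<and> Suc (Suc j) \<notin> A \<and> j \<notin> phi n A"
proof -
  define G where "G = fold (toggle n) [1..<Suc j] A"
  have split: "[1..<Suc n] = [1..<Suc j] @ Suc j # [Suc (Suc j)..<Suc n]"
    using j upt_add_eq_append[of 1 "Suc j" "n - j"] by (simp add: upt_conv_Cons del: upt_Suc)
  have phi: "phi n A = fold (toggle n) [Suc (Suc j)..<Suc n] (toggle n (Suc j) G)"
    unfolding phi_def split G_def by simp
  have "G \<in> indep_sets n" unfolding G_def by (rule fold_toggle_indep[OF A])
  moreover have "Suc j \<in> G \<longleftrightarrow> Suc j \<in> A" "Suc (Suc j) \<in> G \<longleftrightarrow> Suc (Suc j) \<in> A"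
    unfolding G_def by (rule fold_toggle_notin; simp)+
  moreover have "Suc j \<in> phi n A \<longleftrightarrow> Suc j \<in> toggle n (Suc j) G"
    unfolding phi by (rule fold_toggle_notin) simp
  moreover have "j \<in> phi n A \<longleftrightarrow> j \<in> G"
    unfolding phi by (subst fold_toggle_notin) (simp_all add: toggle_other_mem)
  ultimately show ?thesis using toggle_same_mem[of G n j] j by blast
qed

text \<open>The rule fixes the image column by column from the left, starting with the empty column
  0.\<close>

lemma phi_eqI:
  assumes A: "A \<in> indep_sets n" and C: "C \<in> indep_sets n"
    and rule: "\<And>j. Suc j \<le> n \<Longrightarrow> Suc j \<in> C \<longleftrightarrow> Suc j \<notin> A \<and> Suc (Suc j) \<notin> A \<and> j \<notin> C"
  shows "phi n A = C"
proof -
  have P: "phi n A \<in> indep_sets n" using bij_betw_apply[OF bij_betw_phi A] .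
  have "j \<in> phi n A \<longleftrightarrow> j \<in> C" if "j \<le> n" for j
    using that
  proof (induction j)
    case 0
    then show ?case using indep_setsD(1)[OF P] indep_setsD(1)[OF C] by simp
  next
    case (Suc j)
    then show ?case using phi_mem_iff[OF A Suc.prems] rule[OF Suc.prems] by simp
  qed
  then show ?thesis using indep_setsD(2)[OF P] indep_setsD(2)[OF C] by blast
qed

section \<open>Integer powers of \<open>phi\<close> and orbits\<close>

lemma phi_power_0 [simp]: "phi_power n 0 A = A"
  by (simp add: phi_power_def)

lemma inv_into_phi_power_mem:
  "A \<in> indep_sets n \<Longrightarrow> (inv_into (indep_sets n) (phi n) ^^ m) A \<in> indep_sets n"
  by (induction m) (auto intro: bij_betw_apply[OF bij_betw_inv_into[OF bij_betw_phi]])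

lemma phi_power_mem:
  assumes "A \<in> indep_sets n" shows "phi_power n i A \<in> indep_sets n"
proof -
  have "(phi n ^^ m) A \<in> indep_sets n" for m
    by (induction m) (use assms in \<open>auto intro: bij_betw_apply[OF bij_betw_phi]\<close>)
  then show ?thesis using inv_into_phi_power_mem[OF assms] by (simp add: phi_power_def)
qed

lemma phi_power_succ:
  assumes A: "A \<in> indep_sets n" shows "phi_power n (i + 1) A = phi n (phi_power n i A)"
proof (cases "0 \<le> i")
  case True
  then show ?thesis by (simp add: phi_power_def nat_add_distrib)
next
  case False
  define m where "m = nat (- i - 1)"
  have i: "nat (- i) = Suc m" "nat (- (i + 1)) = m" using False by (simp_all add: m_def)
  have "phi n (phi_power n i A) = (inv_into (indep_sets n) (phi n) ^^ m) A"
    using False i(1) inv_into_phi_power_mem[OF A, of m] bij_betw_phi[of n]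
    by (simp add: phi_power_def bij_betw_def f_inv_into_f)
  then show ?thesis
    using False i(2) by (cases "i = - 1") (auto simp: phi_power_def m_def)
qed

text \<open>Going down from \<open>k\<close> uses that \<open>phi n\<close> is injective on
  \<open>indep_sets n\<close>.\<close>

lemma phi_sequence_unique:
  fixes y z :: "int \<Rightarrow> nat set"
  assumes mem: "\<And>i. y i \<in> indep_sets n" "\<And>i. z i \<in> indep_sets n"
    and succ: "\<And>i. y (i + 1) = phi n (y i)" "\<And>i. z (i + 1) = phi n (z i)"
    and eq: "y k = z k"
  shows "y i = z i"
proof (induction i rule: int_induct[where k = k])
  case (step2 i)
  then have "phi n (y (i - 1)) = phi n (z (i - 1))"
    using succ[of "i - 1"] by simp
  then show ?case using bij_betw_phi mem by (meson bij_betw_def inj_onD)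
qed (simp_all add: eq succ)

lemma phi_power_add:
  assumes "A \<in> indep_sets n"
  shows "phi_power n i (phi_power n k A) = phi_power n (i + k) A"
  by (rule phi_sequence_unique[where n = n and k = 0
        and y = "\<lambda>i. phi_power n i (phi_power n k A)" and z = "\<lambda>i. phi_power n (i + k) A"])
    (use assms phi_power_succ[of A n "_ + k"] in
      \<open>auto simp: phi_power_mem phi_power_succ algebra_simps\<close>)

text \<open>The offset \<open>r\<close> allows numbering the rows from the start of a given
  snake.\<close>

lemma phi_orbit_eq:
  assumes "A \<in> indep_sets n" "C \<in> phi_orbit n A"
  shows "C \<in> indep_sets n" "phi_orbit n A = range (\<lambda>i. phi_power n (i + r) C)"
proof -
  obtain k where C: "C = phi_power n k A" using assms(2) by (auto simp: phi_orbit_def)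
  show "C \<in> indep_sets n" using C assms(1) phi_power_mem by simp
  have "phi_power n i A = phi_power n (i - k - r + r) C" for i
    using C phi_power_add[OF assms(1)] by simp
  moreover have "phi_power n (i + r) C = phi_power n (i + r + k) A" for i
    using C phi_power_add[OF assms(1)] by simp
  ultimately show "phi_orbit n A = range (\<lambda>i. phi_power n (i + r) C)"
    unfolding phi_orbit_def by blast
qed

section \<open>Periodic functions on the integers\<close>

lemma periodic_mult:
  fixes p :: int
  assumes "\<And>k. f (k + p) = f k"
  shows "f (k + m * p) = f k"
proof (induction m rule: int_induct[where k = 0])
  case (step1 m)
  then show ?case using assms[of "k + m * p"] by (simp add: algebra_simps)
next
  case (step2 m)
  then show ?case using assms[of "k + (m - 1) * p"] by (simp add: algebra_simps)
qed simp

lemma card_range_periodic: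
  fixes p :: int
  assumes p: "0 < p" "\<And>i. f (i + p) = f i"
    and least: "\<And>i r. 0 < r \<Longrightarrow> r < p \<Longrightarrow> f (i + r) \<noteq> f i"
  shows "int (card (range f)) = p"
proof -
  have "f i \<in> f ` {0..<p}" for i
    using periodic_mult[of f, OF p(2), of "i mod p" "i div p"] p(1)
    by (intro image_eqI[of _ _ "i mod p"]) simp_all
  then have "range f = f ` {0..<p}" by blast
  moreover have "inj_on f {0..<p}"
  proof (rule linorder_inj_onI)
    fix a b assume "a < b" "a \<in> {0..<p}" "b \<in> {0..<p}"
    then show "f a \<noteq> f b" using least[of "b - a" a] by auto
  qed auto
  ultimately show ?thesis using p(1) by (simp add: card_image)
qed

section \<open>The candidate board built from a height function\<close>

locale snake_heights =
  fixes D :: "int \<Rightarrow> int" and l :: int and n :: nat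
  assumes D_0 [simp]: "D 0 = 0"
    and D_step: "D (k + 1) = D k \<or> D (k + 1) = D k + 1"
    and D_periodic: "D (k + l) = D k + D l"
    and l_pos: "0 < l"
    and width: "2 * l - D l = int n - 1"
    and n_ge_2: "2 \<le> n"
begin

definition W :: "int \<Rightarrow> int" where "W k = 2 * k - D k"

text \<open>The second equation is the column formula rewritten by means of the first; in the
  coordinates \<open>(i, i + j - 1)\<close> the roles of \<open>a\<close> and \<open>b\<close>
  become symmetric.\<close>

definition B :: "int \<Rightarrow> int \<Rightarrow> bool" where
  "B i j \<longleftrightarrow> 1 \<le> j \<and> j \<le> int n \<and> (\<exists>a b. i = 2 * a + D b \<and> i + j - 1 = 2 * b + D a)"

definition row :: "int \<Rightarrow> nat set" where "row i = {j. B i (int j)}"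

lemma D_mono: "a \<le> b \<Longrightarrow> D a \<le> D b \<and> D b - D a \<le> b - a"
proof (induction b rule: int_ge_induct)
  case (step b)
  then show ?case using D_step[of b] by linarith
qed simp

lemma D_abs: "\<bar>D a\<bar> \<le> \<bar>a\<bar>"
  using D_mono[of 0 a] D_mono[of a 0] by (cases "0 \<le> a") auto

lemma W_step: "W k + 1 \<le> W (k + 1)" "W (k + 1) \<le> W k + 2"
  using D_step[of k] by (auto simp: W_def)

lemma W_less: "a < b \<Longrightarrow> b - a \<le> W b - W a"
  using D_mono[of a b] by (simp add: W_def)

lemma B_iff_W:
  "B i j \<longleftrightarrow> 1 \<le> j \<and> j \<le> int n \<and> (\<exists>a b. i = 2 * a + D b \<and> j = 1 + W b - W a)"
  unfolding B_def W_def by (intro conj_cong refl ex_cong1) auto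

text \<open>A change of \<open>a\<close> has to be offset by an opposite change of \<open>b\<close>.
  As \<open>D\<close> is monotone and changes no faster than its argument, this throws the other
  coordinate out of range.\<close>

lemma separated:
  assumes "2 * a' + D b' = 2 * a + D b + e" "2 * b' + D a' = 2 * b + D a + f"
    and "e \<in> {0, 1}" "f \<in> {0, 1}"
  shows "e = 0 \<and> f = 0"
proof -
  have "D a' - D a = 0 \<and> a' = a \<or> a' > a \<and> D a \<le> D a' \<and> D a' - D a \<le> a' - a
    \<or> a' < a \<and> D a' \<le> D a \<and> D a - D a' \<le> a - a'"
    using D_mono[of a a'] D_mono[of a' a] by linarith
  moreover have "D b' - D b = 0 \<and> b' = b \<or> b' > b \<and> D b \<le> D b' \<and> D b' - D b \<le> b' - b
    \<or> b' < b \<and> D b' \<le> D b \<and> D b - D b' \<le> b - b'"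
    using D_mono[of b b'] D_mono[of b' b] by linarith
  ultimately show ?thesis using assms by auto
qed

text \<open>The offsets \<open>e\<close> and \<open>f\<close> refer to the coordinates
  \<open>(i, i + j - 1)\<close>, so a one at \<open>(i, j)\<close> excludes ones at
  \<open>(i, j + 1)\<close>, \<open>(i + 1, j - 1)\<close> and \<open>(i + 1, j)\<close>.\<close>

lemma B_separated:
  assumes "B i j" "B (i + e) (j + f - e)" "e \<in> {0, 1}" "f \<in> {0, 1}"
  shows "e = 0 \<and> f = 0"
proof -
  from assms(1) obtain a b where 1: "i = 2 * a + D b" "i + j - 1 = 2 * b + D a"
    unfolding B_def by blast
  from assms(2) obtain a' b' where
    2: "i + e = 2 * a' + D b'" "i + e + (j + f - e) - 1 = 2 * b' + D a'"
    unfolding B_def by blast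
  show ?thesis by (rule separated[of a' b' a b e f]) (use 1 2 assms(3,4) in simp_all)
qed

text \<open>In the coordinates \<open>(i, i + j - 1)\<close> the toggling rule says that the ones meet every
  two-by-two square. The required \<open>b\<close> is a fixed point of a monotone map, as in the
  Knaster--Tarski theorem.\<close>

lemma square_covered:
  "\<exists>a b. 2 * a + D b \<in> {u, u + 1} \<and> 2 * b + D a \<in> {v, v + 1}"
proof -
  \<comment> \<open>Given \<open>b\<close>, \<open>f b\<close> solves the first condition for
    \<open>a\<close>, and \<open>F b\<close> then solves the second for a new \<open>b\<close>;
    \<open>F\<close> is monotone because \<open>f\<close> is antitone.\<close>
  define f where "f b = (u - D b + 1) div 2" for b
  define F where "F b = (v - D (f b) + 1) div 2" for b
  \<comment> \<open>Chosen so large that \<open>F\<close> sends both ends of \<open>{- M..M}\<close>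
    into this interval.\<close>
  define M where "M = \<bar>u\<bar> + \<bar>v\<bar> + 2"
  have F_mono: "F b \<le> F b'" if "b \<le> b'" for b b'
  proof -
    have "f b' \<le> f b" unfolding f_def using D_mono[OF that] by (intro zdiv_mono1) auto
    then show ?thesis unfolding F_def using D_mono by (intro zdiv_mono1) auto
  qed
  have F_bound: "\<bar>F b\<bar> \<le> M" if "\<bar>b\<bar> = M" for b
  proof -
    have "2 * \<bar>f b\<bar> \<le> \<bar>u\<bar> + M + 1" unfolding f_def using D_abs[of b] that by linarith
    moreover have "2 * \<bar>F b\<bar> \<le> \<bar>v\<bar> + \<bar>f b\<bar> + 1" unfolding F_def using D_abs[of "f b"] by linarith
    ultimately show ?thesis unfolding M_def by linarith
  qed
  \<comment> \<open>The greatest element of \<open>X\<close> is the fixed point, because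
    \<open>F\<close> maps it into \<open>X\<close> again.\<close>
  define X where "X = {b \<in> {- M..M}. b \<le> F b}"
  have fin: "finite X" by (rule finite_subset[of _ "{- M..M}"]) (auto simp: X_def)
  have "- M \<in> X" unfolding X_def using F_bound[of "- M"] by (auto simp: M_def)
  then have Max_in: "Max X \<in> X" using fin by (intro Max_in) auto
  moreover have "F (Max X) \<le> M"
  proof -
    have "Max X \<le> M" using Max_in by (simp add: X_def)
    then have "F (Max X) \<le> F M" by (rule F_mono)
    also have "F M \<le> M" using F_bound[of M] by (simp add: M_def)
    finally show ?thesis .
  qed
  ultimately have "F (Max X) \<in> X" using F_mono by (auto simp: X_def)
  then have "F (Max X) \<le> Max X" by (rule Max_ge[OF fin])
  moreover have "Max X \<le> F (Max X)" using Max_in by (simp add: X_def)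
  ultimately have fixp: "F (Max X) = Max X" by simp
  define b where "b = Max X"
  have "2 * f b + D b \<in> {u, u + 1}" unfolding f_def by auto
  moreover have "2 * F b + D (f b) \<in> {v, v + 1}" unfolding F_def by auto
  ultimately show ?thesis using fixp unfolding b_def by metis
qed

lemma B_I: "i = 2 * a + D b \<Longrightarrow> i + j - 1 = 2 * b + D a \<Longrightarrow> 1 \<le> j \<Longrightarrow> j \<le> int n \<Longrightarrow> B i j"
  unfolding B_def by blast

lemma D_succ_l: "D (a + l) = D a + D l" "D (a + l + 1) = D (a + 1) + D l"
  using D_periodic[of a] D_periodic[of "a + 1"] by (simp_all add: algebra_simps)

text \<open>A covering point may fall into the column 0 or \<open>n + 1\<close>, outside the board. It then comes
  from a part 1, and exchanging the roles of the endpoints of this part yields the opposite corner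
  of the square, which lies on the board.\<close>

lemma B_covered:
  assumes j: "1 \<le> j" "j \<le> int n"
  shows "B i j \<or> B (i + 1) j \<or> B (i + 1) (j - 1) \<or> B i (j + 1)"
proof -
  obtain a b where ab: "2 * a + D b = i \<or> 2 * a + D b = i + 1"
      "2 * b + D a = i + j - 1 \<or> 2 * b + D a = i + j"
    using square_covered[of i "i + j - 1"] by auto
  consider "2 * a + D b = i" "2 * b + D a = i + j - 1"
    | "2 * a + D b = i + 1" "2 * b + D a = i + j"
    | "2 * a + D b = i + 1" "2 * b + D a = i + j - 1" "j \<noteq> 1"
    | "2 * a + D b = i" "2 * b + D a = i + j" "j \<noteq> int n"
    | "2 * a + D b = i + 1" "2 * b + D a = i + j - 1" "j = 1"
    | "2 * a + D b = i" "2 * b + D a = i + j" "j = int n"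
    using ab by blast
  then show ?thesis
  proof cases
    case 1
    then show ?thesis using B_I[of i a b j] j by simp
  next
    case 2
    then show ?thesis using B_I[of "i + 1" a b j] j by simp
  next
    case 3
    then show ?thesis using B_I[of "i + 1" a b "j - 1"] j by simp
  next
    case 4
    then show ?thesis using B_I[of i a b "j + 1"] j by simp
  next
    case 5
    then have W: "W a = W b + 1" by (simp add: W_def)
    then have "a = b + 1" 
      using W_less[of a b] W_less[of b a] by (cases a b rule: linorder_cases) auto
    moreover from this have "D (b + 1) = D b + 1" using W by (simp add: W_def)
    ultimately show ?thesis using B_I[of i b "b + 1" 2] 5 n_ge_2 by simp
  next
    case 6
    \<comment> \<open>Snake \<open>a\<close> reaches column \<open>n\<close> at position
      \<open>a + l\<close>, so a point in column \<open>n + 1\<close> can only be one letter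
      further.\<close>
    have "W (a + l) = W a + int n - 1" using width D_succ_l(1)[of a] by (simp add: W_def)
    moreover have W: "W b = W a + int n" using 6 by (simp add: W_def)
    ultimately have b: "b = a + l + 1"
      using W_less[of "a + l" b] W_less[of b "a + l"]
      by (cases b "a + l" rule: linorder_cases) auto
    moreover from this have "D (a + 1) = D a + 1"
      using W D_succ_l(2)[of a] width by (simp add: W_def)
    ultimately have "B (i + 1) (j - 1)"
      using 6 n_ge_2 D_succ_l[of a] by (intro B_I[of _ "a + 1" "a + l"]) simp_all
    then show ?thesis by simp
  qed
qed

text \<open>At least one of the four cells holds a one by \<open>B_covered\<close>, and a one at
  \<open>(i + 1, j)\<close> excludes the other three by \<open>B_separated\<close>.\<close>

lemma B_rule:
  assumes "1 \<le> j" "j \<le> int n"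
  shows "B (i + 1) j \<longleftrightarrow> \<not> B i j \<and> \<not> B i (j + 1) \<and> \<not> B (i + 1) (j - 1)"
  using B_covered[OF assms, of i] B_separated[of i j 1 1] B_separated[of i "j + 1" 1 0]
    B_separated[of "i + 1" "j - 1" 0 1] by auto

lemma row_indep: "row i \<in> indep_sets n"
proof -
  have "\<not> (B i (int j) \<and> B i (int (Suc j)))" for j
    using B_separated[of i "int j" 0 1] by (auto simp: add.commute)
  moreover have "B i j \<Longrightarrow> 1 \<le> j \<and> j \<le> int n" for j by (simp add: B_def)
  ultimately show ?thesis by (fastforce simp: indep_sets_def row_def)
qed

lemma phi_row: "phi n (row i) = row (i + 1)"
proof (rule phi_eqI[OF row_indep row_indep])
  fix j assume "Suc j \<le> n"
  then show "Suc j \<in> row (i + 1) \<longleftrightarrow>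
      Suc j \<notin> row i \<and> Suc (Suc j) \<notin> row i \<and> j \<notin> row (i + 1)"
    using B_rule[of "int (Suc j)" i] by (simp add: row_def add_ac)
qed

section \<open>The snake determines the board\<close>

lemma W_l: "W l = int n - 1"
  using width by (simp add: W_def)

lemma W_le: "t \<le> l \<Longrightarrow> W t \<le> int n - 1"
  using W_less[of t l] W_l by (cases "t = l") auto

text \<open>The given snake is the case \<open>a = 0\<close> of the candidate board.\<close>

lemma snake_in_row:
  assumes "0 \<le> t" "t \<le> l" shows "nat (1 + W t) \<in> row (D t)"
proof -
  have "0 \<le> W t" using D_mono[OF assms(1)] assms(1) by (simp add: W_def)
  then have "B (D t) (1 + W t)"
    using W_le[OF assms(2)] by (intro B_I[of _ 0 t]) (simp_all add: W_def)
  then show ?thesis using \<open>0 \<le> W t\<close> by (simp add: row_def)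
qed

text \<open>The induction reaches exactly the cells weakly below the snake.\<close>

lemma agrees_below_snake:
  fixes y :: "int \<Rightarrow> nat set"
  assumes y: "\<And>i. y i \<in> indep_sets n" and succ: "\<And>i. y (i + 1) = phi n (y i)"
    and snake: "\<And>t. 0 \<le> t \<Longrightarrow> t \<le> l \<Longrightarrow> nat (1 + W t) \<in> y (D t)"
  shows "\<lbrakk>0 \<le> t; t \<le> l; 1 \<le> j; int j \<le> 1 + W t; D t \<le> int m\<rbrakk>
    \<Longrightarrow> j \<in> y (int m) \<longleftrightarrow> j \<in> row (int m)"
proof (induction m arbitrary: j t rule: less_induct)
  case (less m)
  note row_IH = less.IH
  \<comment> \<open>Within row \<open>m\<close> the columns are treated from left to right.\<close>
  from less.prems show ?case
  proof (induction j arbitrary: t rule: less_induct)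
    case (less j)
    \<comment> \<open>The first position at which the snake reaches or passes column
      \<open>j\<close>. As a letter is at most 2, the snake is then in column \<open>j\<close> or
      \<open>j + 1\<close>.\<close>
    define k where "k = (LEAST k. int j \<le> 1 + W (int k))"
    have ex: "int j \<le> 1 + W (int (nat t))" using less.prems by simp
    have k: "int j \<le> 1 + W (int k)" unfolding k_def using ex by (rule LeastI)
    have "k \<le> nat t" unfolding k_def using ex by (rule Least_le)
    then have kt: "int k \<le> t" using less.prems by linarith
    have kl: "int k \<le> l" using kt less.prems by linarith
    have Dk: "D (int k) \<le> int m" using D_mono[OF kt] less.prems by linarith
    have k_pred: "1 + W (int k - 1) < int j" if "k > 0"
      using not_less_Least[of "k - 1" "\<lambda>k. int j \<le> 1 + W (int k)"] that
      unfolding k_def[symmetric] by (simp add: of_nat_diff)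
    have onsnake: "nat (1 + W (int k)) \<in> y (D (int k))" "nat (1 + W (int k)) \<in> row (D (int k))"
      using snake[of "int k"] snake_in_row[of "int k"] kl by simp_all
    show ?case
    proof (cases "D (int k) = int m")
      case True
      show ?thesis
      proof (cases "int j = 1 + W (int k)")
        case True
        then have "nat (1 + W (int k)) = j" by linarith
        then show ?thesis using onsnake \<open>D (int k) = int m\<close> by simp
      next
        case False
        then have "k > 0" using k less.prems by (cases "k = 0") (auto simp: W_def)
        then have "int j = W (int k)"
          using False k k_pred W_step(2)[of "int k - 1"] by simp
        \<comment> \<open>The snake skips column \<open>j\<close> here, so the cell is next to a
          common one and is zero on both boards.\<close>
        then have "nat (1 + W (int k)) = Suc j" by linarith
        then show ?thesis
          using onsnake \<open>D (int k) = int m\<close> indep_setsD(3)[OF y] indep_setsD(3)[OF row_indep]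
          by metis
      qed
    next
      case False
      moreover have "0 \<le> D (int k)" using D_mono[of 0 "int k"] by simp
      ultimately obtain p where m: "m = Suc p" and Dp: "D (int k) \<le> int p"
        using Dk by (cases m) auto
      obtain r where r: "j = Suc r" using less.prems by (cases j) auto
      have jn: "j \<le> n" using k W_le[OF kl] by linarith
      have m': "int m = int p + 1" using m by simp
      have rules: "j \<in> y (int m) \<longleftrightarrow> j \<notin> y (int p) \<and> Suc j \<notin> y (int p) \<and> r \<notin> y (int m)"
        "j \<in> row (int m) \<longleftrightarrow> j \<notin> row (int p) \<and> Suc j \<notin> row (int p) \<and> r \<notin> row (int m)"
        using phi_mem_iff[OF y, of r "int p"] phi_mem_iff[OF row_indep, of r "int p"] jn
        unfolding m' succ phi_row[symmetric] r by auto
      have above: "j \<in> y (int p) \<longleftrightarrow> j \<in> row (int p)"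
        using row_IH[of p "int k" j] m kl less.prems k Dp by simp
      have left: "r \<in> y (int m) \<longleftrightarrow> r \<in> row (int m)"
      proof (cases "r = 0")
        case True
        then show ?thesis using indep_setsD(1)[OF y] indep_setsD(1)[OF row_indep] by simp
      next
        case False
        then show ?thesis using less.IH[of r "int k"] r kl k Dk by simp
      qed
      \<comment> \<open>Only the upper right cell, in row \<open>p\<close> and column
        \<open>Suc j\<close>, remains; it may lie off the board or fail to be below the
        snake.\<close>
      consider "j = n" | "int (Suc j) \<le> 1 + W (int k)" | "j \<noteq> n" "int j = 1 + W (int k)"
        using k by linarith
      then show ?thesis
      proof cases
        case 1
        then have "Suc j \<notin> y (int p)" "Suc j \<notin> row (int p)"
          using indep_setsD(2)[OF y] indep_setsD(2)[OF row_indep] by fastforce+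
        then show ?thesis using rules above left by simp
      next
        case 2
        then show ?thesis using row_IH[of p "int k" "Suc j"] m kl Dp rules above left by simp
      next
        case 3
        then have "int k \<noteq> l" using W_l by auto
        then have kl': "int k + 1 \<le> l" using kl by linarith
        show ?thesis
        proof (cases "D (int k + 1) \<le> int p")
          case True
          moreover have "int (Suc j) \<le> 1 + W (int k + 1)" using 3 W_step(1)[of "int k"] by simp
          ultimately show ?thesis
            using row_IH[of p "int k + 1" "Suc j"] m kl' rules above left by simp
        next
          case False
          \<comment> \<open>The cell directly above is a one of the snake, so the rule gives zero on
            both boards whatever the upper right cell is.\<close>
          then have "D (int k) = int p" using Dp D_step[of "int k"] by linarith
          moreover have "nat (1 + W (int k)) = j" using 3 by linarith
          ultimately show ?thesis using onsnake rules by simp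
        qed
      qed
    qed
  qed
qed

text \<open>The snake ends in row \<open>D l\<close> and column \<open>n\<close>, so this whole row
  is weakly below it; agreement in one row spreads to all rows.\<close>

lemma eq_row:
  fixes y :: "int \<Rightarrow> nat set"
  assumes y: "\<And>i. y i \<in> indep_sets n" and succ: "\<And>i. y (i + 1) = phi n (y i)"
    and snake: "\<And>t. 0 \<le> t \<Longrightarrow> t \<le> l \<Longrightarrow> nat (1 + W t) \<in> y (D t)"
  shows "y = row"
proof
  have Dl: "int (nat (D l)) = D l" using D_mono[of 0 l] l_pos by simp
  have "j \<in> y (D l) \<longleftrightarrow> j \<in> row (D l)" for j
  proof (cases "1 \<le> j \<and> j \<le> n")
    case True
    then show ?thesis
      using agrees_below_snake[OF y succ snake, of l j "nat (D l)"] Dl l_pos W_l by simp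
  next
    case False
    then show ?thesis
      using indep_setsD(1,2)[OF y] indep_setsD(1,2)[OF row_indep]
      by (metis One_nat_def Suc_leI neq0_conv)
  qed
  then have "y (D l) = row (D l)" by blast
  then show "y i = row i" for i
    using phi_sequence_unique[where y = y and z = row, OF y row_indep succ phi_row[symmetric]]
    by blast
qed

section \<open>Periods of the rows\<close>

lemma row_shift:
  assumes "\<And>k. D (k + q) = D k + D q"
  shows "row (i + (2 * q + D q)) = row i"
proof -
  have *: "B (i + (2 * q + D q)) j" if "B i j" "\<And>k. D (k + q) = D k + D q" for i j q
  proof -
    obtain a b where "i = 2 * a + D b" "i + j - 1 = 2 * b + D a" "1 \<le> j" "j \<le> int n"
      using \<open>B i j\<close> unfolding B_def by blast
    \<comment> \<open>Adding \<open>q\<close> to both \<open>a\<close> and \<open>b\<close> moves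
      the row by \<open>2 * q + D q\<close> and keeps the column.\<close>
    then show ?thesis using that(2) by (intro B_I[of _ "a + q" "b + q"]) simp_all
  qed
  \<comment> \<open>The reverse inclusion is the shift by \<open>- q\<close>.\<close>
  have "D (- q) = - D q" using assms[of "- q"] by simp
  moreover from this have "D (k + - q) = D k + D (- q)" for k using assms[of "k - q"] by simp
  ultimately have "B i j" if "B (i + (2 * q + D q)) j" for j
    using *[OF that, of "- q"] by simp
  then show ?thesis using *[OF _ assms] unfolding row_def by blast
qed

text \<open>\<open>W\<close> is strictly increasing, so column 1 forces
  \<open>a = b\<close>.\<close>

lemma B_col_1: "B i 1 \<longleftrightarrow> (\<exists>a. i = 2 * a + D a)"
proof -
  have "W a = W b \<longleftrightarrow> a = b" for a b using W_less[of a b] W_less[of b a] by force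
  then show ?thesis using n_ge_2 by (auto simp: B_iff_W)
qed

text \<open>Consecutive ones of column 1 are 2 or 3 rows apart, according to the letter between
  them; hence this column determines the word.\<close>

lemma B_col_1_next:
  "B (2 * a + D a + 2) 1 \<longleftrightarrow> D (a + 1) = D a"
  "B (2 * a + D a - 2) 1 \<longleftrightarrow> D (a - 1) = D a"
proof -
  have "D (a + 1) = D a" if "2 * a + D a + 2 = 2 * b + D b" for b
  proof -
    have "b = a + 1" using that D_mono[of a b] D_mono[of b a] by linarith
    then show ?thesis using that by simp
  qed
  then show "B (2 * a + D a + 2) 1 \<longleftrightarrow> D (a + 1) = D a" unfolding B_col_1 by (auto intro!: exI[of _ "a + 1"])
  have "D (a - 1) = D a" if "2 * a + D a - 2 = 2 * b + D b" for b
  proof -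
    have "b = a - 1" using that D_mono[of a b] D_mono[of b a] by linarith
    then show ?thesis using that by simp
  qed
  then show "B (2 * a + D a - 2) 1 \<longleftrightarrow> D (a - 1) = D a" unfolding B_col_1 by (auto intro!: exI[of _ "a - 1"])
qed

text \<open>A converse of \<open>row_shift\<close>: comparing the gaps in column 1 at the snakes
  \<open>k\<close> and \<open>k + q\<close> extends the equation from \<open>k = 0\<close> in both
  directions.\<close>

lemma row_period:
  assumes P: "0 < P" and period: "\<And>i. row (i + P) = row i"
  obtains q where "0 < q" "P = 2 * q + D q" "\<And>k. D (k + q) = D k + D q"
proof -
  have shift: "B (i + P) 1 \<longleftrightarrow> B i 1" for i
    using period[of i] unfolding row_def by (metis mem_Collect_eq of_nat_1)
  have "B 0 1" unfolding B_col_1 by (intro exI[of _ 0]) simp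
  \<comment> \<open>\<open>q\<close> is the number of the snake that starts in row
    \<open>P\<close>.\<close>
  then obtain q where q: "P = 2 * q + D q" using shift[of 0] unfolding B_col_1 by auto
  have "0 < q" using P q D_mono[of q 0] by (cases "0 < q") auto
  moreover have "D (k + q) = D k + D q" for k
  proof (induction k rule: int_induct[where k = 0])
    case (step1 k)
    have "2 * (k + q) + D (k + q) + 2 = 2 * k + D k + 2 + P" using step1 q by simp
    then have "D (k + q + 1) = D (k + q) \<longleftrightarrow> D (k + 1) = D k"
      using shift[of "2 * k + D k + 2"] B_col_1_next(1) by metis
    then show ?case using D_step[of k] D_step[of "k + q"] step1 by (simp add: add_ac) linarith
  next
    case (step2 k)
    have "2 * (k + q) + D (k + q) - 2 = 2 * k + D k - 2 + P" using step2 q by simp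
    then have "D (k + q - 1) = D (k + q) \<longleftrightarrow> D (k - 1) = D k"
      using shift[of "2 * k + D k - 2"] B_col_1_next(2) by metis
    then show ?case using D_step[of "k - 1"] D_step[of "k + q - 1"] step2
      by (simp add: algebra_simps) linarith
  qed simp
  ultimately show ?thesis using that q by blast
qed

text \<open>A coincidence of two rows spreads to all rows and so gives a period of \<open>D\<close>;
  as \<open>2 * q + D q\<close> grows with \<open>q\<close>, the least periods correspond.\<close>

lemma card_range_row:
  assumes q: "0 < q" "\<And>k. D (k + q) = D k + D q"
    and least: "\<And>q'. 0 < q' \<Longrightarrow> (\<And>k. D (k + q') = D k + D q') \<Longrightarrow> q \<le> q'"
  shows "int (card (range row)) = 2 * q + D q"
proof -
  have pos: "0 < 2 * q + D q" using q(1) D_mono[of 0 q] by simp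
  have "row (i + P) \<noteq> row i" if P: "0 < P" "P < 2 * q + D q" for i P
  proof
    assume eq: "row (i + P) = row i"
    have "row (k + P) = row k" for k
      by (rule phi_sequence_unique[where y = "\<lambda>k. row (k + P)" and z = row and k = i and n = n])
        (simp_all add: row_indep phi_row eq add_ac eq[unfolded add.commute[of i P]])
    then obtain q' where "0 < q'" "P = 2 * q' + D q'" "\<And>k. D (k + q') = D k + D q'"
      using row_period[OF P(1)] by metis
    then show False using least[of q'] D_mono[of q q'] P(2) by simp
  qed
  then show ?thesis using card_range_periodic[where f = row, OF pos row_shift[OF q(2)]] by blast
qed

end

section \<open>Two-sided partial sums\<close>

definition height :: "(int \<Rightarrow> int) \<Rightarrow> int \<Rightarrow> int" where
  "height d k = (\<Sum>s\<in>{0..<k}. d s) - (\<Sum>s\<in>{k..<0}. d s)"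

lemma height_0 [simp]: "height d 0 = 0"
  by (simp add: height_def)

text \<open>At least one of the two sums is always empty, which makes the recurrence hold on both
  sides of 0.\<close>

lemma height_succ: "height d (k + 1) = height d k + d k"
proof (cases "0 \<le> k")
  case True
  then have "{0..<k + 1} = insert k {0..<k}" by auto
  then show ?thesis using True by (simp add: height_def)
next
  case False
  then have "{k..<0} = insert k {k + 1..<0}" by auto
  then show ?thesis using False by (simp add: height_def)
qed

text \<open>Differences give one direction, summation from 0 both ways gives the other.\<close>

lemma height_add_iff:
  "(\<forall>k. height d (k + q) = height d k + height d q) \<longleftrightarrow> (\<forall>k. d (k + q) = d k)"
proof safe
  fix k assume *: "\<forall>k. height d (k + q) = height d k + height d q"
  show "d (k + q) = d k"
    using height_succ[of d k] height_succ[of d "k + q"] *[rule_format, of k]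
      *[rule_format, of "k + 1"] by (simp add: add_ac)
next
  fix k assume *: "\<forall>k. d (k + q) = d k"
  show "height d (k + q) = height d k + height d q"
  proof (induction k rule: int_induct[where k = 0])
    case (step1 k)
    then show ?case using height_succ[of d k] height_succ[of d "k + q"] * by (simp add: add_ac)
  next
    case (step2 k)
    have "d (k + q - 1) = d (k - 1)" using *[rule_format, of "k - 1"] by (simp add: algebra_simps)
    then show ?case using height_succ[of d "k - 1"] height_succ[of d "k - 1 + q"] step2
      by (simp add: algebra_simps)
  qed simp
qed

section \<open>Periodic words and \<open>psi\<close>\<close>

definition cyc :: "'a list \<Rightarrow> int \<Rightarrow> 'a" where
  "cyc c k = c ! nat (k mod int (length c))"

lemma cyc_nth: "t < length c \<Longrightarrow> cyc c (int t) = c ! t"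
  by (simp add: cyc_def)

lemma cyc_in_set: "c \<noteq> [] \<Longrightarrow> cyc c k \<in> set c"
  unfolding cyc_def by (intro nth_mem) (simp add: nat_less_iff)

lemma cyc_length: "cyc c (k + int (length c)) = cyc c k"
  by (simp add: cyc_def)

lemma concat_replicate_nth:
  "i < m * length d \<Longrightarrow> concat (replicate m d) ! i = d ! (i mod length d)"
proof (induction m arbitrary: i)
  case (Suc m)
  then show ?case by (cases "i < length d") (auto simp: nth_append le_mod_geq)
qed simp

lemma length_concat_replicate: "length (concat (replicate m d)) = m * length d"
  by (induction m) auto

lemma cyc_concat_replicate:
  assumes "c = concat (replicate m d)" "c \<noteq> []"
  shows "cyc c k = cyc d k"
proof -
  have l: "length c = m * length d" using assms(1) length_concat_replicate by metis
  then have "0 < m * length d" using assms(2) by (metis length_greater_0_conv)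
  then have r: "0 \<le> k mod int (length c)" "nat (k mod int (length c)) < m * length d"
    using l by (simp_all add: nat_less_iff)
  have "cyc c k = d ! (nat (k mod int (length c)) mod length d)"
    unfolding cyc_def using concat_replicate_nth[OF r(2)] assms(1) by simp
  also have "nat (k mod int (length c)) mod length d = nat (k mod int (length d))"
    using r(1) l by (simp add: nat_mod_distrib[symmetric] mod_mod_cancel zmod_int nat_mod_as_int)
  finally show ?thesis by (simp add: cyc_def)
qed

text \<open>A period dividing the length sends every index back to the first \<open>g\<close>
  letters.\<close>

lemma concat_replicate_take:
  assumes c: "c \<noteq> []" and g: "0 < g" "g dvd length c"
    and period: "\<And>k. cyc c (k + int g) = cyc c k"
  shows "c = concat (replicate (length c div g) (take g c))"
proof (rule nth_equalityI)
  have gl: "length (take g c) = g" using g c by (auto dest: dvd_imp_le)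
  then show len: "length c = length (concat (replicate (length c div g) (take g c)))"
    using g by (simp add: length_concat_replicate)
  fix i assume i: "i < length c"
  have "cyc c (int (i mod g)) = cyc c (int i)"
    using periodic_mult[of "cyc c", OF period, of "int (i mod g)" "int (i div g)"]
    by (metis mod_mult_div_eq of_nat_add of_nat_mult mult.commute)
  moreover have "i mod g < length c" using i by (meson mod_less_eq_dividend order.strict_trans1)
  ultimately have "c ! i = c ! (i mod g)" using i by (simp add: cyc_nth)
  then show "c ! i = concat (replicate (length c div g) (take g c)) ! i"
    using concat_replicate_nth[of i "length c div g" "take g c"] i gl g by simp
qed

text \<open>The set of repetition numbers contains 1 and is bounded by \<open>length c\<close>, so
  its maximum is attained.\<close>

lemma
  assumes c: "c \<noteq> []"
  shows psi_repetition: "\<exists>d. c = concat (replicate (psi c) d)"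
    and psi_greatest: "c = concat (replicate k d) \<Longrightarrow> k \<le> psi c"
proof -
  let ?K = "{k. \<exists>d. c = concat (replicate k d)}"
  have "k \<le> length c" if k: "c = concat (replicate k d)" for k d
  proof -
    have "length c = k * length d" using k length_concat_replicate by metis
    moreover have "d \<noteq> []" using k c by auto
    ultimately show ?thesis by (cases d) auto
  qed
  then have fin: "finite ?K" by (intro finite_subset[of ?K "{..length c}"]) auto
  have "c = concat (replicate 1 c)" by simp
  then have "?K \<noteq> {}" by blast
  then have "psi c \<in> ?K" unfolding psi_def using fin by (intro Max_in)
  then show "\<exists>d. c = concat (replicate (psi c) d)" by simp
  show "c = concat (replicate k d) \<Longrightarrow> k \<le> psi c" unfolding psi_def using fin by (auto intro: Max_ge)
qed

text \<open>By Bezout, the gcd of a period \<open>p\<close> and \<open>length c\<close> is again a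
  period; it cuts \<open>c\<close> into equal blocks, whose number is at most
  \<open>psi c\<close>.\<close>

lemma psi_least_period:
  fixes c :: "'a list"
  assumes c: "c \<noteq> []"
  obtains q where "0 < q" "psi c * q = length c" "\<And>k. cyc c (k + int q) = cyc c k"
    "\<And>p. 0 < p \<Longrightarrow> (\<And>k. cyc c (k + p) = cyc c k) \<Longrightarrow> int q \<le> p"
proof -
  obtain d where d: "c = concat (replicate (psi c) d)" using psi_repetition[OF c] by blast
  define q where "q = length d"
  have l: "psi c * q = length c" using d length_concat_replicate q_def by metis
  then have pos: "0 < psi c" "0 < q" using c by (auto intro!: Nat.gr0I)
  have "int q \<le> p" if p: "0 < p" "\<And>k. cyc c (k + p) = cyc c k" for p
  proof -
    define g where "g = nat (gcd p (int (length c)))"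
    have g: "int g = gcd p (int (length c))" by (simp add: g_def)
    have gpos: "0 < g" using p(1) g by (metis gcd_pos_int less_irrefl of_nat_0_less_iff)
    have gdvd: "g dvd length c" using g by (metis gcd_dvd2 int_dvd_int_iff)
    obtain a b where ab: "a * p + b * int (length c) = int g"
      using bezout_int[of p "int (length c)"] g by auto
    have "cyc c (k + int g) = cyc c k" for k
      using periodic_mult[of "cyc c", OF p(2), of k a]
        periodic_mult[of "cyc c", OF cyc_length, of "k + a * p" b] ab
      by (simp add: add.assoc)
    then have "length c div g \<le> psi c"
      using psi_greatest[OF c concat_replicate_take[OF c gpos gdvd]] by blast
    then have "psi c * q \<le> psi c * g" using l gdvd by (metis dvd_div_mult_self mult_le_mono1)
    then have "q \<le> g" using pos by simp
    moreover have "int g \<le> p" using g p(1) by (simp add: zdvd_imp_le)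
    ultimately show ?thesis by linarith
  qed
  moreover have "cyc c (k + int q) = cyc c k" for k
    using cyc_concat_replicate[OF d c] cyc_length[of d k] q_def by simp
  ultimately show ?thesis using that pos(2) l by blast
qed

section \<open>Letters of a snake composition\<close>

lemma length_snake_composition: "length (snake_composition ps) = length ps - 1"
  by (induction ps rule: snake_composition.induct) auto

lemma snake_composition_nth:
  "Suc k < length ps \<Longrightarrow> snake_composition ps ! k =
    (if ps ! Suc k = (fst (ps ! k), snd (ps ! k) + 2) then 2 else 1)"
proof (induction ps arbitrary: k rule: snake_composition.induct)
  case (1 i j p ps)
  then show ?case by (cases k) auto
qed auto

lemma set_snake_composition: "set (snake_composition ps) \<subseteq> {1, 2}"
  by (induction ps rule: snake_composition.induct) auto

section \<open>The cardinality of the orbit\<close>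

theorem proposition4p3:
  fixes n :: nat and orb :: "nat set set" and S :: "nat set"
    and snake :: "(int \<times> nat) list" and c :: "nat list"
  assumes "n \<ge> 2"
    and "orb \<in> phi_orbits n"
    and "S \<in> orb"
    and "is_snake n S snake"
    and "c = snake_composition snake"
  shows "real (card orb) =
    (3 * real (count_list c 1) + 2 * real (count_list c 2)) / real (psi c)"
proof -
  \<comment> \<open>For the letters 1 and 2 this is 2 minus the letter, the number of rows that the
    step descends.\<close>
  define d :: "int \<Rightarrow> int" where "d k = (if cyc c k = 1 then 1 else 0)" for k
  define D where "D = height d"
  define l where "l = length c"
  define i0 where "i0 = fst (snake ! 0)"
  have D_succ: "D (k + 1) = D k + d k" for k unfolding D_def by (rule height_succ)
  have d_range: "d k = 0 \<or> d k = 1" for k by (simp add: d_def)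
  \<comment> \<open>Keeps \<open>nat\<close> from truncating the column numbers below.\<close>
  have D_le: "D (int t) \<le> int t" for t
  proof (induction t)
    case (Suc t)
    then show ?case using D_succ[of "int t"] d_range[of "int t"] by (auto simp: add.commute)
  qed (simp add: D_def)
  have len: "length snake = Suc l"
    using assms(4) length_snake_composition[of snake] by (simp add: assms(5) l_def is_snake_def)
  have pos: "snake ! t = (i0 + D (int t), nat (1 + 2 * int t - D (int t)))" if "t \<le> l" for t
    using that
  proof (induction t)
    case 0
    have "snd (snake ! 0) = 1" using assms(4) len by (cases snake) (auto simp: is_snake_def)
    then show ?case by (simp add: i0_def D_def prod_eq_iff)
  next
    case (Suc t)
    then have t: "snake ! t = (i0 + D (int t), nat (1 + 2 * int t - D (int t)))" by simp
    then have "snake ! Suc t = (i0 + D (int t), nat (1 + 2 * int t - D (int t)) + 2) \<or>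
        snake ! Suc t = (i0 + D (int t) + 1, nat (1 + 2 * int t - D (int t)) + 1)"
    proof -
      have "let (i, j) = snake ! t in
          snake ! Suc t = (i, j + 2) \<or> snake ! Suc t = (i + 1, j + 1)"
        using assms(4) Suc.prems len unfolding is_snake_def by auto
      then show ?thesis using t by simp
    qed
    moreover have "cyc c (int t) =
        (if snake ! Suc t = (i0 + D (int t), nat (1 + 2 * int t - D (int t)) + 2) then 2 else 1)"
      using snake_composition_nth[of t snake] cyc_nth[of t c] Suc.prems len t
      by (simp add: assms(5) l_def)
    ultimately show ?case
      using D_succ[of "int t"] D_le[of t] by (auto simp: d_def add.commute nat_eq_iff split: if_splits)
  qed
  have "last snake = snake ! l" using len by (subst last_conv_nth) auto
  then have "snd (snake ! l) = n" using assms(4) by (simp add: is_snake_def)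
  then have width: "2 * int l - D (int l) = int n - 1"
    using pos[of l] D_le[of l] by simp
  then have l_pos: "0 < l" using assms(1) by (cases l) (auto simp: D_def)
  then have c: "c \<noteq> []" by (auto simp: l_def)
  \<comment> \<open>The letters are 1 or 2, so \<open>d\<close> determines them and has the same
    periods.\<close>
  have period_iff: "(\<forall>k. D (k + q) = D k + D q) \<longleftrightarrow> (\<forall>k. cyc c (k + q) = cyc c k)" for q
  proof -
    have "cyc c k = 1 \<or> cyc c k = 2" for k
      using cyc_in_set[OF c, of k] set_snake_composition[of snake] assms(5) by blast
    then have "d (k + q) = d k \<longleftrightarrow> cyc c (k + q) = cyc c k" for k
      unfolding d_def by (metis one_neq_zero)
    then show ?thesis unfolding D_def height_add_iff by simp
  qed
  interpret snake_heights D "int l" n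
  proof
    show "D (k + int l) = D k + D (int l)" for k
      using period_iff[of "int l"] cyc_length[of c] by (simp add: l_def)
    show "D (k + 1) = D k \<or> D (k + 1) = D k + 1" for k using D_succ[of k] d_range[of k] by auto
  qed (use assms(1) width l_pos in \<open>simp_all add: D_def\<close>)
  obtain S0 where S0: "S0 \<in> indep_sets n" "orb = phi_orbit n S0"
    using assms(2) by (auto simp: phi_orbits_def)
  have S: "S \<in> indep_sets n" and orb: "orb = range (\<lambda>i. phi_power n (i + i0) S)"
    using phi_orbit_eq[OF S0(1)] assms(3) S0(2) by blast+
  \<comment> \<open>Row \<open>i0\<close> of the orbit board is renumbered 0, where the snake of the
    candidate board starts.\<close>
  have "(\<lambda>i. phi_power n (i + i0) S) = row"
  proof (rule eq_row)
    show "phi_power n (i + 1 + i0) S = phi n (phi_power n (i + i0) S)" for i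
      using phi_power_succ[OF S, of "i + i0"] by (simp add: add_ac)
    fix t :: int assume t: "0 \<le> t" "t \<le> int l"
    then have "snake ! nat t \<in> set snake" using len by simp
    then have "orbit_board n S (i0 + D t) (nat (1 + 2 * t - D t)) = 1"
      using assms(4) pos[of "nat t"] t by (auto simp: is_snake_def)
    then show "nat (1 + W t) \<in> phi_power n (D t + i0) S"
      by (simp add: orbit_board_def W_def add.commute add_diff_eq split: if_splits)
  qed (rule phi_power_mem[OF S])
  then have orb_row: "orb = range row" unfolding orb by (rule arg_cong)
  obtain q where q: "0 < q" "psi c * q = l" "\<And>k. cyc c (k + int q) = cyc c k"
      "\<And>p. 0 < p \<Longrightarrow> (\<And>k. cyc c (k + p) = cyc c k) \<Longrightarrow> int q \<le> p"
    using psi_least_period[OF c] unfolding l_def by blast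
  have Dq: "D (k + int q) = D k + D (int q)" for k using period_iff q(3) by blast
  have card: "int (card orb) = 2 * int q + D (int q)"
    unfolding orb_row
  proof (rule card_range_row)
    show "int q \<le> p" if "0 < p" "\<And>k. D (k + p) = D k + D p" for p
      using q(4)[OF that(1)] that(2) period_iff by blast
  qed (use q(1) Dq in simp_all)
  \<comment> \<open>The word \<open>c\<close> consists of \<open>psi c\<close> blocks of length
    \<open>q\<close>, over each of which \<open>D\<close> grows by \<open>D q\<close>.\<close>
  have "D (int m * int q) = int m * D (int q)" for m
  proof (induction m)
    case (Suc m)
    then show ?case using Dq[of "int m * int q"] by (simp add: algebra_simps)
  qed simp
  from this[of "psi c"] have "int (psi c) * D (int q) = D (int l)" using q(2) by (metis of_nat_mult)
  moreover have "D (int t) = int (count_list (take t c) 1)" if "t \<le> l" for t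
    using that
  proof (induction t)
    case (Suc t)
    then show ?case using D_succ[of "int t"] cyc_nth[of t c]
      by (simp add: d_def l_def take_Suc_conv_app_nth add.commute)
  qed simp
  ultimately have "int (psi c) * D (int q) = int (count_list c 1)" by (simp add: l_def)
  moreover have "l = count_list c 1 + count_list c 2"
  proof -
    have "set c \<subseteq> {1, 2}" using set_snake_composition assms(5) by simp
    then have "length c = (\<Sum>x\<in>{1, 2}. count_list c x)"
      by (metis sum_count_set finite.emptyI finite_insert)
    then show ?thesis by (simp add: l_def)
  qed
  moreover have "int (psi c) * int q = int l" using q(2) by (metis of_nat_mult)
  \<comment> \<open>Three times the number of 1s plus twice the number of 2s is
    \<open>2 * l + D l\<close>, that is \<open>psi c\<close> times
    \<open>2 * q + D q\<close>.\<close>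
  ultimately have "int (card orb) * int (psi c) =
      3 * int (count_list c 1) + 2 * int (count_list c 2)"
    unfolding card by (simp add: algebra_simps)
  then have "real_of_int (int (card orb) * int (psi c)) =
      real_of_int (3 * int (count_list c 1) + 2 * int (count_list c 2))" by (rule arg_cong)
  then have "real (card orb) * real (psi c) =
      3 * real (count_list c 1) + 2 * real (count_list c 2)" by simp
  moreover have "psi c \<noteq> 0" using q(2) l_pos by (intro notI) simp
  ultimately show ?thesis by (simp add: field_simps)
qed

end
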